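(* Let $k$ and $n$ be positive integers. If $$F_1+2F_2+\cdots+kF_k=F_n,$$ then $(k,n)\in\{(1,1),(1,2),(2,4),(4,8)\}$; among these solutions only $(4,8)$ is non-trivial.
   Context: $(F_n)_{n\ge 0}$ is the Fibonacci sequence: $F_0=0$, $F_1=1$, $F_{n+2}=F_{n+1}+F_n$ for all $n\ge 0$. The left-hand side of the equation is $\sum_{j=1}^k jF_j$. For fixed positive integers $p,q$, the trivial solutions of $\sum_{j=1}^k jF_j^p=F_n^q$ in positive integers $k,n$ are those coming from $F_1^p=1=F_1^q=F_2^q$, i.e. $(k,n)=(1,1),(1,2)$, and from $F_1^p+2F_2^p=3=F_4$, i.e. $(k,n)=(2,4)$ when $q=1$; all other solutions are called non-trivial. *)

theory Defs
  imports "HOL-Number_Theory.Fib"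
begin

definition is_solution :: "nat \<Rightarrow> nat \<Rightarrow> nat \<times> nat \<Rightarrow> bool" where
  "is_solution p q = (\<lambda>(k, n). k > 0 \<and> n > 0 \<and> (\<Sum>j = 1..k. j * fib j ^ p) = fib n ^ q)"

text \<open>
  The first two pairs come from \<open>F\<^sub>1\<^sup>p = 1 = F\<^sub>1\<^sup>q = F\<^sub>2\<^sup>q\<close>, the pair \<open>(2, 4)\<close> from
  \<open>F\<^sub>1\<^sup>p + 2 F\<^sub>2\<^sup>p = 3 = F\<^sub>4\<close>, which gives a solution only for \<open>q = 1\<close>. None of the
  three depends on \<open>p\<close>.
\<close>

definition trivial_solutions :: "nat \<Rightarrow> (nat \<times> nat) set" where
  "trivial_solutions q = {(1, 1), (1, 2)} \<union> (if q = 1 then {(2, 4)} else {})"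

definition nontrivial_solution :: "nat \<Rightarrow> nat \<Rightarrow> nat \<times> nat \<Rightarrow> bool" where
  "nontrivial_solution p q s \<longleftrightarrow> is_solution p q s \<and> s \<notin> trivial_solutions q"

end

theory Submission
  imports Defs
begin

text \<open>
  Since \<open>\<Sum>j\<le>k. j F\<^sub>j = k F\<^bsub>k+2\<^esub> - F\<^bsub>k+3\<^esub> + 2\<close>, the equation reads
  \<open>F\<^sub>n + F\<^bsub>m+1\<^esub> = k F\<^sub>m + 2\<close> with \<open>m = k + 2\<close>. For \<open>k \<ge> 3\<close> it forces \<open>n \<ge> m\<close>, so write
  \<open>n = m + t\<close>. The addition formula \<open>F\<^bsub>m+t\<^esub> = F\<^bsub>t+1\<^esub> F\<^sub>m + F\<^sub>t F\<^bsub>m-1\<^esub>\<close> then has two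
  consequences. Comparing sizes gives \<open>F\<^bsub>t+1\<^esub> < k\<close>, so \<open>c = F\<^sub>t + 1\<close> is at most \<open>k\<close>, tiny
  compared with \<open>F\<^sub>m\<close>. Reducing modulo \<open>F\<^sub>m\<close> gives \<open>c F\<^bsub>m-1\<^esub> \<equiv> 2\<close>. By Cassini's identity
  \<open>F\<^bsub>m-1\<^esub>\<close> is its own inverse modulo \<open>F\<^sub>m\<close> up to sign, so
  \<open>c \<equiv> \<plusminus>2 F\<^bsub>m-1\<^esub> = \<plusminus>(F\<^sub>m + F\<^bsub>m-3\<^esub>) \<equiv> \<plusminus>F\<^bsub>m-3\<^esub>\<close>.
  Hence \<open>c\<close>, being positive, is at least \<open>F\<^bsub>m-3\<^esub> = F\<^bsub>k-1\<^esub>\<close> (the other residue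
  \<open>F\<^sub>m - F\<^bsub>m-3\<^esub>\<close> is larger still), whereas \<open>F\<^bsub>k-1\<^esub> \<le> k\<close> fails for \<open>k \<ge> 7\<close>. The six
  remaining values of \<open>k\<close> are checked directly.
\<close>

lemma sum_mult_fib: "(\<Sum>j = 1..k. j * fib j) + fib (k + 3) = k * fib (k + 2) + 2"
  by (induction k) (simp_all add: eval_nat_numeral algebra_simps)

lemma less_fib: "i + 2 \<le> fib i" if "6 \<le> i"
  using that
proof (induction i rule: dec_induct)
  case base
  show ?case by (simp add: eval_nat_numeral)
next
  case (step i)
  then have "1 \<le> fib (i - 1)"
    using fib_neq_0_nat[of "i - 1"] by simp
  moreover have "fib (Suc i) = fib i + fib (i - 1)"
    using step.hyps by (cases i) auto
  ultimately show ?case using step.IH by linarith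
qed

text \<open>
  A congruence \<open>c P \<equiv> 2\<close> is solved for \<open>c\<close> by multiplying with \<open>P\<close>, which is its own
  inverse up to sign.
\<close>

lemma dvd_of_square_eq_unit:
  fixes c P M x y e :: int
  assumes cP: "c * P = M * x + 2" and PP: "P * P = M * y + e" and e: "e = 1 \<or> e = -1"
  shows "M dvd c - 2 * P \<or> M dvd c + 2 * P"
proof -
  have "c * (M * y + e) = (M * x + 2) * P"
    using cP PP by (metis mult.assoc)
  then have *: "c * e - 2 * P = M * (x * P - c * y)"
    by (simp add: algebra_simps)
  from e show ?thesis
  proof
    assume "e = 1"
    with * show ?thesis by (metis dvd_triv_left mult.right_neutral)
  next
    assume "e = -1"
    with * have "c + 2 * P = M * - (x * P - c * y)" by (simp add: algebra_simps)
    then show ?thesis by (metis dvd_triv_left)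
  qed
qed

lemma fib_square_eq:
  "int (fib (Suc n)) * int (fib (Suc n)) = int (fib (Suc (Suc n))) * int (fib n) + (-1) ^ n"
  using fib_Cassini_int[of n] by (simp add: power2_eq_square)

lemma not_dvd_between_multiples:
  fixes M z :: int
  assumes "M < z" "z < 2 * M"
  shows "\<not> M dvd z"
proof
  assume "M dvd z"
  then have "M dvd z - M" by simp
  with assms show False by (auto dest: zdvd_imp_le)
qed

text \<open>
  The congruence argument, with \<open>k = i + 1\<close>; thus \<open>F\<^bsub>k-1\<^esub> = F\<^sub>i\<close> and the modulus is
  \<open>F\<^bsub>k+2\<^esub> = F\<^bsub>i+3\<^esub>\<close>.
\<close>

lemma sum_mult_fib_neq_fib:
  assumes "7 \<le> k"
  shows "(\<Sum>j = 1..k. j * fib j) \<noteq> fib n"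
proof
  assume sum_eq: "(\<Sum>j = 1..k. j * fib j) = fib n"
  define i where "i = k - 1"
  have k: "k = Suc i" and i: "6 \<le> i" using assms by (auto simp: i_def)
  define a b where "a = fib i" and "b = fib (Suc i)"
  define P M where "P = fib (i + 2)" and "M = fib (i + 3)"
  have P: "P = a + b" and M: "M = a + 2 * b"
    by (simp_all add: P_def M_def a_def b_def eval_nat_numeral)
  have pos: "0 < a" "0 < b" and "a \<le> b"
    using i fib_neq_0_nat[of i] fib_neq_0_nat[of "Suc i"] fib_Suc_mono[of i]
    by (auto simp: a_def b_def)
  have k_less: "k < a"
    using less_fib[OF i] by (simp add: a_def k)
  have "fib (k + 3) = M + P" "fib (k + 2) = M"
    by (simp_all add: k P_def M_def eval_nat_numeral)
  then have eq: "fib n + M + P = k * M + 2"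
    using sum_mult_fib[of k] sum_eq by simp

  have "i + 3 \<le> n"
  proof (rule ccontr)
    assume "\<not> i + 3 \<le> n"
    then have "fib n \<le> M"
      unfolding M_def by (intro fib_mono) simp
    moreover have "3 * M \<le> k * M"
      using assms by simp
    ultimately show False using eq P M by linarith
  qed
  then obtain t where n: "n = i + 3 + t"
    using le_Suc_ex by blast
  have "fib n = fib (Suc (i + 2 + t))"
    by (simp add: n eval_nat_numeral)
  also have "\<dots> = fib (Suc t) * M + fib t * P"
    unfolding fib_add P_def M_def by (simp add: eval_nat_numeral)
  finally have fib_n: "fib n = fib (Suc t) * M + fib t * P" .

  define c where "c = fib t + 1"
  have "fib (Suc t) * M < k * M"
    using eq fib_n pos k_less assms P by linarith
  then have "fib (Suc t) < k" by simp
  then have c: "0 < c" "c < a"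
    using fib_Suc_mono[of t] k_less by (auto simp: c_def)

  have "int (fib (Suc t) * M + fib t * P + M + P) = int (k * M + 2)"
    using eq fib_n by simp
  then have "int c * int P = int M * (int k - 1 - int (fib (Suc t))) + 2"
    by (simp add: c_def algebra_simps)
  moreover have "int P * int P = int M * int b + (-1) ^ Suc i"
    using fib_square_eq[of "Suc i"] by (simp add: P_def M_def b_def eval_nat_numeral)
  moreover have "(-1) ^ Suc i = (1 :: int) \<or> (-1) ^ Suc i = (-1 :: int)"
    by (cases "even i") auto
  ultimately have "int M dvd int c - 2 * int P \<or> int M dvd int c + 2 * int P"
    by (rule dvd_of_square_eq_unit)
  then have "int M dvd 2 * int P - int c \<or> int M dvd 2 * int P + int c"
    by (metis add.commute dvd_minus_iff minus_diff_eq)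
  \<comment> \<open>As \<open>2 P = M + a\<close>, both numbers lie strictly between \<open>M\<close> and \<open>2 M\<close>.\<close>
  moreover have "\<not> int M dvd 2 * int P - int c"
    using c pos P M by (intro not_dvd_between_multiples) auto
  moreover have "\<not> int M dvd 2 * int P + int c"
    using c \<open>a \<le> b\<close> P M by (intro not_dvd_between_multiples) auto
  ultimately show False by blast
qed

lemma index_less_12_if_fib_less_144: "n < 12" if "fib n < 144"
proof (rule ccontr)
  assume "\<not> n < 12"
  then have "fib 12 \<le> fib n" by (intro fib_mono) simp
  with that show False by (simp add: eval_nat_numeral)
qed

theorem theorem1:
  "(\<forall>k n :: nat. k > 0 \<longrightarrow> n > 0 \<longrightarrow> (\<Sum>j = 1..k. j * fib j) = fib n \<longrightarrow>
      (k, n) \<in> {(1, 1), (1, 2), (2, 4), (4, 8)}) \<and>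
   (\<forall>s \<in> {(1, 1), (1, 2), (2, 4), (4, 8)}. is_solution 1 1 s) \<and>
   {s \<in> {(1, 1), (1, 2), (2, 4), (4, 8)}. nontrivial_solution 1 1 s} = {(4, 8)}"
proof (intro conjI allI impI)
  fix k n :: nat
  assume "0 < k" "0 < n" and eq: "(\<Sum>j = 1..k. j * fib j) = fib n"
  have "k < 7" using eq sum_mult_fib_neq_fib[of k n] by linarith
  with \<open>0 < k\<close> have k: "k \<in> {1, 2, 3, 4, 5, 6}" by auto
  then have sum_val: "(k, fib n) \<in> {(1, 1), (2, 3), (3, 9), (4, 21), (5, 46), (6, 94)}"
    unfolding eq[symmetric] by (auto simp: eval_nat_numeral)
  then have "n < 12" by (intro index_less_12_if_fib_less_144) auto
  with \<open>0 < n\<close> have "n \<in> {1, 2, 3, 4, 5, 6, 7, 8, 9, 10, 11}"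
    by (simp add: eval_nat_numeral less_Suc_eq)
  with sum_val show "(k, n) \<in> {(1, 1), (1, 2), (2, 4), (4, 8)}"
    by (auto simp: eval_nat_numeral)
next
  show solutions: "\<forall>s \<in> {(1, 1), (1, 2), (2, 4), (4, 8)}. is_solution 1 1 s"
    by (simp add: is_solution_def eval_nat_numeral)
  then show "{s \<in> {(1, 1), (1, 2), (2, 4), (4, 8)}. nontrivial_solution 1 1 s} = {(4, 8)}"
    by (auto simp: nontrivial_solution_def trivial_solutions_def)
qed

end
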